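(* Let $X=X(\mathbb R)$ be a Banach lattice on $\mathbb R$ satisfying Assumption A, let $r,s\in\mathbb N$, and let $\mathcal K_{\sigma,r}$, $\sigma>0$, be the Kantorovich-type operators described in the context, with $\mathcal K_{0,r}:=0$. Then there is a constant $C>0$, independent of $f$ and $\sigma$, such that for all $f\in X$ and all $\sigma>0$ $$\|(I-\dot A_{\gamma/\sigma})^s f\|_X\le\frac{C}{\sigma^s}\sum_{\nu=0}^{\lfloor\sigma\rfloor}(\nu+1)^{s-1}\|f-\mathcal K_{\nu,r}f\|_X .$$
   Context: **Banach lattice.** $\mu$ is Lebesgue measure on $\mathbb R$. A Banach lattice $X$ on $\mathbb R$ is a Banach space of measurable functions on $\mathbb R$ with norm $\|\cdot\|_X$ such that: (1) if $f$ is measurable, $g\in X$ and $|f|\le|g|$, then $f\in X$ and $\|f\|_X\le\|g\|_X$; (2) if $f_n\in X$, $\sup_n\|f_n\|_X<\infty$ and $0\le f_n\uparrow f$, then $f\in X$ and $\|f_n\|_X\to\|f\|_X$; (3) if $E\subset\mathbb R$ is measurable with $\mu(E)<\infty$, then $\chi_E\in X$ and there is $c_E>0$ with $\int_E|f|\,d\mu\le c_E\|f\|_X$ for all $f\in X$. **Steklov averages.** For locally integrable $f$ and $h>0$: $A_hf(x)=\frac1h\int_{x-h/2}^{x+h/2}f(t)\,dt$, $\dot A_hf(x)=A_hf(x+h/2)=\frac1h\int_x^{x+h}f(t)\,dt$, and $A_{h,r}f=\sum_{k=1}^r(-1)^{k+1}\binom rk A_h^kf=f-(I-A_h)^rf$.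 **Assumption A.** For all $f\in X$ and $h>0$, $A_hf\in X$, and $\sup_{h>0}\sup_{\|f\|_X\le1}\|A_hf\|_X<\infty$. **Spaces.** $(\Phi_\sigma)_{\sigma}$ is a nested family of linear subspaces of $X$ ($\Phi_{\sigma'}\subset\Phi_\sigma$ for $\sigma'\le\sigma$, $\Phi_0=\{0\}$) satisfying the Bernstein inequality: there is $B>0$ depending only on $X$ with $\|\varphi^{(k)}\|_X\le(B\sigma)^k\|\varphi\|_X$ for all $k\in\mathbb N$, $\varphi\in\Phi_\sigma$ (in particular the derivatives exist and lie in $X$). **Operators.** $\varphi_{k,\sigma}\in\Phi_\sigma$, $k\in\mathbb Z$, and $(x_{k,\sigma})_{k\in\mathbb Z}\subset\mathbb R$ are distinct points for which there are positive constants $\gamma,\gamma'$ (independent of $\sigma,k$) with $\frac\gamma\sigma\le x_{k+1,\sigma}-x_{k,\sigma}\le\frac{\gamma'}\sigma$, $k\in\mathbb Z$. Then $$\mathcal K_{\sigma,r}f(x)=\sum_{k\in\mathbb Z}A_{\gamma/\sigma,r}f(x_{k,\sigma})\,\varphi_{k,\sigma}(x).$$ **Standing assumptions.** The series defining $\mathcal K_{\sigma,r}f$ converges in the norm of $X$ for every $f\in X$. To guarantee this when the kernels $\varphi_{k,\sigma}$ are not compactly supported, it is additionally required that $X$ has order continuous norm ($f_n\downarrow0$ a.e. implies $\|f_n\|_X\to0$) and contains the Schwartz space $\mathcal S$ as a dense subspace. *)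

theory Defs
  imports "HOL-Analysis.Analysis"
begin

text \<open>
  The scalar type 'a ranges over the real normed fields of finite dimension, that is, over the
  reals and the complex numbers, so both real and complex lattices are covered.
  A space \<open>X\<close> is a set of functions together with a functional \<open>N\<close> on functions; elements of the
  Banach space are the classes of members of \<open>X\<close> modulo equality almost everywhere. Only the
  values of \<open>N\<close> on \<open>X\<close> are meaningful.
\<close>

definition linear_subspace :: "(real \<Rightarrow> 'a::{real_normed_field,euclidean_space}) set \<Rightarrow> bool" where
  "linear_subspace V \<longleftrightarrow>
     (\<lambda>_. 0) \<in> V \<and>
     (\<forall>f\<in>V. \<forall>g\<in>V. (\<lambda>x. f x + g x) \<in> V) \<and>
     (\<forall>c. \<forall>f\<in>V. (\<lambda>x. c * f x) \<in> V)"

text \<open>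
  In \<open>fatou\<close> the limit \<open>v\<close> is finite-valued. A limit with values in \<open>[0,\<infinity>]\<close> is automatically
  finite almost everywhere, by \<open>integral_bound\<close> and monotone convergence.
  The \<open>ideal\<close> property makes \<open>X\<close> and \<open>N\<close> invariant under changes on null sets.
\<close>

locale banach_lattice =
  fixes X :: "(real \<Rightarrow> 'a::{real_normed_field,euclidean_space}) set"
    and N :: "(real \<Rightarrow> 'a) \<Rightarrow> real"
  assumes measurable: "X \<subseteq> borel_measurable lebesgue"
    and subspace: "linear_subspace X"
    and norm_nonneg: "f \<in> X \<Longrightarrow> 0 \<le> N f"
    and norm_eq_0_iff: "f \<in> X \<Longrightarrow> N f = 0 \<longleftrightarrow> (AE x in lebesgue. f x = 0)"
    and norm_scale: "f \<in> X \<Longrightarrow> N (\<lambda>x. c * f x) = norm c * N f"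
    and norm_triangle: "f \<in> X \<Longrightarrow> g \<in> X \<Longrightarrow> N (\<lambda>x. f x + g x) \<le> N f + N g"
    and complete:
      "\<lbrakk>\<And>n::nat. F n \<in> X; \<And>e. e > 0 \<Longrightarrow> \<exists>M. \<forall>m\<ge>M. \<forall>n\<ge>M. N (\<lambda>x. F m x - F n x) < e\<rbrakk>
        \<Longrightarrow> \<exists>g\<in>X. (\<lambda>n. N (\<lambda>x. F n x - g x)) \<longlonglongrightarrow> 0"
    and ideal:
      "\<lbrakk>f \<in> borel_measurable lebesgue; g \<in> X; AE x in lebesgue. norm (f x) \<le> norm (g x)\<rbrakk>
        \<Longrightarrow> f \<in> X \<and> N f \<le> N g"
    and fatou:
      "\<lbrakk>\<And>n::nat. (\<lambda>x. of_real (u n x)) \<in> X;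
        bdd_above (range (\<lambda>n. N (\<lambda>x. of_real (u n x))));
        AE x in lebesgue. (\<forall>n. 0 \<le> u n x) \<and> incseq (\<lambda>n. u n x) \<and> (\<lambda>n. u n x) \<longlonglongrightarrow> v x\<rbrakk>
        \<Longrightarrow> (\<lambda>x. of_real (v x)) \<in> X \<and>
            (\<lambda>n. N (\<lambda>x. of_real (u n x))) \<longlonglongrightarrow> N (\<lambda>x. of_real (v x))"
    and indicator_mem:
      "\<lbrakk>E \<in> sets lebesgue; emeasure lebesgue E < \<infinity>\<rbrakk> \<Longrightarrow> indicator E \<in> X"
    and integral_bound:
      "\<lbrakk>E \<in> sets lebesgue; emeasure lebesgue E < \<infinity>\<rbrakk>
        \<Longrightarrow> \<exists>c>0. \<forall>f\<in>X. (\<integral>\<^sup>+x\<in>E. ennreal (norm (f x)) \<partial>lebesgue) \<le> ennreal (c * N f)"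

definition steklov ::
    "real \<Rightarrow> (real \<Rightarrow> 'a::{real_normed_field,euclidean_space}) \<Rightarrow> real \<Rightarrow> 'a" where
  "steklov h f x = (LINT t:{x - h/2..x + h/2}|lebesgue. f t) /\<^sub>R h"

definition steklov_dot ::
    "real \<Rightarrow> (real \<Rightarrow> 'a::{real_normed_field,euclidean_space}) \<Rightarrow> real \<Rightarrow> 'a" where
  "steklov_dot h f x = steklov h f (x + h/2)"

definition steklov_r ::
    "real \<Rightarrow> nat \<Rightarrow> (real \<Rightarrow> 'a::{real_normed_field,euclidean_space}) \<Rightarrow> real \<Rightarrow> 'a" where
  "steklov_r h r f x = (\<Sum>k=1..r. (-1) ^ (k + 1) * of_nat (r choose k) * (steklov h ^^ k) f x)"

definition assumption_A ::
    "(real \<Rightarrow> 'a::{real_normed_field,euclidean_space}) set \<Rightarrow> ((real \<Rightarrow> 'a) \<Rightarrow> real) \<Rightarrow> bool" where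
  "assumption_A X N \<longleftrightarrow>
     (\<forall>f\<in>X. \<forall>h>0. steklov h f \<in> X) \<and>
     bdd_above {N (steklov h f) | h f. h > 0 \<and> f \<in> X \<and> N f \<le> 1}"

definition nth_deriv ::
    "nat \<Rightarrow> (real \<Rightarrow> 'a::{real_normed_field,euclidean_space}) \<Rightarrow> real \<Rightarrow> 'a" where
  "nth_deriv k = (\<lambda>f x. vector_derivative f (at x)) ^^ k"

definition smooth :: "(real \<Rightarrow> 'a::{real_normed_field,euclidean_space}) \<Rightarrow> bool" where
  "smooth f \<longleftrightarrow> (\<forall>k x. nth_deriv k f differentiable (at x))"

text \<open>
  The classes in \<open>\<Phi> \<sigma>\<close> have derivatives of all orders, so each of them contains exactly one
  smooth function; \<open>\<Phi> \<sigma>\<close> is given as the set of these smooth representatives.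
  The index \<open>\<sigma>\<close> ranges over the nonnegative reals.
\<close>

definition bernstein_family ::
    "(real \<Rightarrow> 'a::{real_normed_field,euclidean_space}) set \<Rightarrow> ((real \<Rightarrow> 'a) \<Rightarrow> real) \<Rightarrow>
     (real \<Rightarrow> (real \<Rightarrow> 'a) set) \<Rightarrow> bool" where
  "bernstein_family X N \<Phi> \<longleftrightarrow>
     (\<forall>\<sigma>\<ge>0. linear_subspace (\<Phi> \<sigma>) \<and> \<Phi> \<sigma> \<subseteq> X) \<and>
     (\<forall>\<sigma>' \<sigma>. 0 \<le> \<sigma>' \<and> \<sigma>' \<le> \<sigma> \<longrightarrow> \<Phi> \<sigma>' \<subseteq> \<Phi> \<sigma>) \<and>
     \<Phi> 0 = {\<lambda>_. 0} \<and>
     (\<exists>B>0. \<forall>\<sigma>\<ge>0. \<forall>\<phi>\<in>\<Phi> \<sigma>. smooth \<phi> \<and>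
        (\<forall>k. nth_deriv k \<phi> \<in> X \<and> N (nth_deriv k \<phi>) \<le> (B * \<sigma>) ^ k * N \<phi>))"

text \<open>
  Convergence in \<open>X\<close> of a series over the integers: the lower and the upper limit of summation
  tend to infinity independently of each other.
\<close>

definition norm_sums ::
    "(real \<Rightarrow> 'a::{real_normed_field,euclidean_space}) set \<Rightarrow> ((real \<Rightarrow> 'a) \<Rightarrow> real) \<Rightarrow>
     (int \<Rightarrow> real \<Rightarrow> 'a) \<Rightarrow> (real \<Rightarrow> 'a) \<Rightarrow> bool" where
  "norm_sums X N u g \<longleftrightarrow> g \<in> X \<and>
     ((\<lambda>(m, n). N (\<lambda>x. g x - (\<Sum>k = - int m..int n. u k x))) \<longlongrightarrow> 0)
       (sequentially \<times>\<^sub>F sequentially)"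

definition kantorovich_term ::
    "real \<Rightarrow> (real \<Rightarrow> int \<Rightarrow> real) \<Rightarrow> (real \<Rightarrow> int \<Rightarrow> real \<Rightarrow> 'a) \<Rightarrow> nat \<Rightarrow> real \<Rightarrow>
     (real \<Rightarrow> 'a::{real_normed_field,euclidean_space}) \<Rightarrow> int \<Rightarrow> real \<Rightarrow> 'a" where
  "kantorovich_term \<gamma> p \<phi> r \<sigma> f k x = steklov_r (\<gamma> / \<sigma>) r f (p \<sigma> k) * \<phi> \<sigma> k x"

text \<open>
  The sum of the series is an element of \<open>X\<close>, hence determined up to null sets; \<open>SOME\<close> picks a
  representative. It is used only where the series is assumed to converge.
\<close>

definition kantorovich ::
    "(real \<Rightarrow> 'a::{real_normed_field,euclidean_space}) set \<Rightarrow> ((real \<Rightarrow> 'a) \<Rightarrow> real) \<Rightarrow>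
     real \<Rightarrow> (real \<Rightarrow> int \<Rightarrow> real) \<Rightarrow> (real \<Rightarrow> int \<Rightarrow> real \<Rightarrow> 'a) \<Rightarrow> nat \<Rightarrow> real \<Rightarrow>
     (real \<Rightarrow> 'a) \<Rightarrow> real \<Rightarrow> 'a" where
  "kantorovich X N \<gamma> p \<phi> r \<sigma> f =
     (if \<sigma> = 0 then (\<lambda>_. 0) else (SOME g. norm_sums X N (kantorovich_term \<gamma> p \<phi> r \<sigma> f) g))"

definition compactly_supported :: "(real \<Rightarrow> 'a::{real_normed_field,euclidean_space}) \<Rightarrow> bool" where
  "compactly_supported f \<longleftrightarrow> compact (closure {x. f x \<noteq> 0})"

definition order_continuous_norm ::
    "(real \<Rightarrow> 'a::{real_normed_field,euclidean_space}) set \<Rightarrow> ((real \<Rightarrow> 'a) \<Rightarrow> real) \<Rightarrow> bool" where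
  "order_continuous_norm X N \<longleftrightarrow>
     (\<forall>u :: nat \<Rightarrow> real \<Rightarrow> real.
        (\<forall>n. (\<lambda>x. of_real (u n x)) \<in> X) \<and>
        (AE x in lebesgue. decseq (\<lambda>n. u n x) \<and> (\<lambda>n. u n x) \<longlonglongrightarrow> 0)
        \<longrightarrow> (\<lambda>n. N (\<lambda>x. of_real (u n x))) \<longlonglongrightarrow> 0)"

definition schwartz :: "(real \<Rightarrow> 'a::{real_normed_field,euclidean_space}) set" where
  "schwartz = {f. smooth f \<and> (\<forall>k m. bounded (range (\<lambda>x. x ^ m *\<^sub>R nth_deriv k f x)))}"

definition dense_subspace ::
    "(real \<Rightarrow> 'a::{real_normed_field,euclidean_space}) set \<Rightarrow> ((real \<Rightarrow> 'a) \<Rightarrow> real) \<Rightarrow>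
     (real \<Rightarrow> 'a) set \<Rightarrow> bool" where
  "dense_subspace X N V \<longleftrightarrow> linear_subspace V \<and> V \<subseteq> X \<and>
     (\<forall>f\<in>X. \<forall>e>0. \<exists>g\<in>V. N (\<lambda>x. f x - g x) < e)"

end

theory Submission
  imports Defs
begin

text \<open>
  The theorem is an inverse theorem of approximation theory. The operators enter it through
  two facts: \<open>K\<^sub>\<nu> f\<close> lies in the norm closure of \<open>\<Phi> \<nu>\<close>, being a limit of partial
  sums of functions from \<open>\<Phi> \<nu>\<close>, and \<open>K\<^sub>0 f = 0\<close>.

  Write \<open>D\<close> for the difference operator \<open>g \<mapsto> g - steklov_dot h g\<close> with \<open>h = \<gamma> / \<sigma>\<close>.
  By Assumption A it is bounded on \<open>X\<close> uniformly in \<open>h\<close>, because the one-sided average of \<open>f\<close> is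
  dominated by twice the centred average of \<open>\<bar>f\<bar>\<close> over an interval of double length. For smooth
  \<open>g\<close> the fundamental theorem of calculus dominates \<open>D g\<close> by \<open>h\<close> times the one-sided average of
  \<open>\<bar>g'\<bar>\<close>. Since \<open>D\<close> commutes with differentiation, iteration gives
  \<open>N (D^s g) \<le> (M h)^s N (g^(s))\<close> (\<open>steklov_diff_funpow_le_derivative\<close>), and with the Bernstein
  inequality \<open>N (D^s g) \<le> (K h \<tau>)^s N g\<close> for \<open>g \<in> \<Phi> \<tau>\<close>. Both sides are continuous in \<open>g\<close>, so
  this extends to the norm closure of \<open>\<Phi> \<tau>\<close> (\<open>bernstein_norm_closure\<close>).

  The errors \<open>a \<nu> = N (f - K\<^sub>\<nu> f)\<close> need not decrease in \<open>\<nu>\<close>. Hence the usual dyadic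
  decomposition does not use the indices \<open>2^j\<close>; instead, in every block \<open>2^(j-1) \<le> \<nu> < 2^j\<close>
  with \<open>j \<ge> 1\<close> it takes an index \<open>m j\<close> at which the error is smallest, so that \<open>a (m j)\<close> is at
  most the average error over the block (\<open>dyadic_minimizers\<close>). Put \<open>m 0 = 0\<close> and
  \<open>P\<^sub>j = K\<^bsub>m j\<^esub> f\<close>, so that \<open>P\<^sub>0 = 0\<close>. With \<open>2^n\<close> comparable to \<open>\<sigma>\<close>,
  or \<open>n = 0\<close> for small \<open>\<sigma>\<close>, split
  \<open>f = (f - P\<^sub>n) + (\<Sum>j<n. P\<^bsub>j+1\<^esub> - P\<^sub>j)\<close>. The first term is estimated by the boundedness of
  \<open>D\<close>, and the differences, which lie in the closure of \<open>\<Phi> (2^(j+1))\<close>, by the Bernstein bound.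
  This is \<open>inverse_approximation\<close>, which treats arbitrary approximants from these closures, the
  zeroth being \<open>0\<close>.
\<close>

section \<open>Linear subspaces of functions\<close>

lemma linear_subspace_add:
  "linear_subspace V \<Longrightarrow> f \<in> V \<Longrightarrow> g \<in> V \<Longrightarrow> (\<lambda>x. f x + g x) \<in> V"
  by (simp add: linear_subspace_def)

lemma linear_subspace_scale:
  "linear_subspace V \<Longrightarrow> f \<in> V \<Longrightarrow> (\<lambda>x. c * f x) \<in> V"
  by (simp add: linear_subspace_def)

lemma linear_subspace_diff:
  assumes V: "linear_subspace V" and "f \<in> V" "g \<in> V"
  shows "(\<lambda>x. f x - g x) \<in> V"
  using linear_subspace_add[OF V assms(2) linear_subspace_scale[OF V assms(3), of "-1"]] by simp

lemma linear_subspace_sum: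
  assumes V: "linear_subspace V" and mem: "\<And>i. i \<in> I \<Longrightarrow> u i \<in> V"
  shows "(\<lambda>x. \<Sum>i\<in>I. c i * u i x) \<in> V"
  using mem
proof (induction I rule: infinite_finite_induct)
  case (insert i I)
  then have "(\<lambda>x. c i * u i x) \<in> V" "(\<lambda>x. \<Sum>i\<in>I. c i * u i x) \<in> V"
    using linear_subspace_scale[OF V] by auto
  from linear_subspace_add[OF V this] insert.hyps show ?case by simp
qed (use V in \<open>auto simp: linear_subspace_def\<close>)

section \<open>One-sided averages of smooth functions\<close>

lemma steklov_dot_eq: "steklov_dot h f x = (LINT t:{x..x + h}|lebesgue. f t) /\<^sub>R h"
  by (simp add: steklov_dot_def steklov_def add.assoc)

lemma steklov_dot_eq_integral:
  fixes f :: "real \<Rightarrow> 'a::{real_normed_field,euclidean_space}"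
  assumes "continuous_on UNIV f"
  shows "steklov_dot h f x = integral {x..x + h} f /\<^sub>R h"
proof -
  have "set_integrable lebesgue {x..x + h} f"
    by (rule absolutely_integrable_continuous_real) (use assms continuous_on_subset in blast)
  then show ?thesis
    unfolding steklov_dot_eq by (simp add: set_lebesgue_integral_eq_integral)
qed

lemma steklov_dot_derivative_eq:
  fixes g :: "real \<Rightarrow> 'a::{real_normed_field,euclidean_space}"
  assumes h: "h > 0" and g: "\<And>x. (g has_vector_derivative g' x) (at x)"
    and g': "continuous_on UNIV g'"
  shows "steklov_dot h g' x = (g (x + h) - g x) /\<^sub>R h"
proof -
  have "(g' has_integral (g (x + h) - g x)) {x..x + h}"
    by (rule fundamental_theorem_of_calculus)
      (use h in \<open>auto intro: has_vector_derivative_at_within g\<close>)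
  then show ?thesis
    by (simp add: steklov_dot_eq_integral[OF g'] integral_unique)
qed

text \<open>
  Averaging commutes with differentiation: near \<open>x\<close> the average is a difference quotient of an
  antiderivative of \<open>g\<close>, so its derivative is a difference quotient of \<open>g\<close>, which is the average
  of \<open>g'\<close>.
\<close>

lemma steklov_dot_has_vector_derivative:
  fixes g :: "real \<Rightarrow> 'a::{real_normed_field,euclidean_space}"
  assumes h: "h > 0" and g: "\<And>x. (g has_vector_derivative g' x) (at x)"
    and g': "continuous_on UNIV g'"
  shows "(steklov_dot h g has_vector_derivative steklov_dot h g' x) (at x)"
proof -
  have cont: "continuous_on UNIV g"
    using g by (meson continuous_at_imp_continuous_on has_vector_derivative_continuous)
  \<comment> \<open>The interval \<open>[a, b]\<close> contains \<open>[y, y + h]\<close> for all \<open>y\<close> in a neighbourhood of \<open>x\<close>.\<close>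
  define a b where "a = x - 1" and "b = x + h + 1"
  obtain G where G: "\<And>y. y \<in> {a..b} \<Longrightarrow> (G has_vector_derivative g y) (at y within {a..b})"
    using antiderivative_continuous[of a b g] cont continuous_on_subset by blast
  have G_at: "(G has_vector_derivative g y) (at y)" if "y \<in> {a<..<b}" for y
    using G[of y] that by (simp add: at_within_Icc_at)
  have avg: "steklov_dot h g y = (G (y + h) - G y) /\<^sub>R h" if y: "y \<in> {x - 1<..<x + 1}" for y
  proof -
    have "(g has_integral (G (y + h) - G y)) {y..y + h}"
    proof (rule fundamental_theorem_of_calculus)
      fix t assume t: "t \<in> {y..y + h}"
      show "(G has_vector_derivative g t) (at t within {y..y + h})"
        by (rule has_vector_derivative_at_within, rule G_at) (use t y in \<open>auto simp: a_def b_def\<close>)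
    qed (use h in simp)
    then show ?thesis
      by (simp add: steklov_dot_eq_integral[OF cont] integral_unique)
  qed
  have shift: "((\<lambda>y. G (y + h)) has_vector_derivative g (x + h)) (at x)"
  proof -
    have 1: "((\<lambda>y. y + h) has_vector_derivative 1) (at x)"
      by (auto intro!: derivative_eq_intros)
    have 2: "(G has_vector_derivative g (x + h)) (at (x + h))"
      by (rule G_at) (use h in \<open>auto simp: a_def b_def\<close>)
    show ?thesis
      using vector_diff_chain_at[OF 1 2] by (simp add: o_def)
  qed
  have "((\<lambda>y. (1 / h) *\<^sub>R (G (y + h) - G y)) has_vector_derivative (1 / h) *\<^sub>R (g (x + h) - g x)) (at x)"
    by (rule bounded_linear.has_vector_derivative[OF bounded_linear_scaleR_right])
      (rule has_vector_derivative_diff[OF shift G_at], use h in \<open>auto simp: a_def b_def\<close>)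
  then have "((\<lambda>y. (G (y + h) - G y) /\<^sub>R h) has_vector_derivative steklov_dot h g' x) (at x)"
    by (simp add: steklov_dot_derivative_eq[OF h g g'] divide_inverse)
  then show ?thesis
    by (rule has_vector_derivative_transform_within_open[where S = "{x - 1<..<x + 1}"])
      (auto simp: avg)
qed

text \<open>
  On \<open>[x, x + h]\<close> the function \<open>g\<close> differs from \<open>g x\<close> by at most the integral of \<open>\<bar>g'\<bar>\<close> over
  that interval, and so does its average. The modulus is written as a scalar of type \<open>'a\<close> because
  the lattice consists of functions with values there.
\<close>

lemma norm_diff_steklov_dot_le:
  fixes g :: "real \<Rightarrow> 'a::{real_normed_field,euclidean_space}"
  assumes h: "h > 0" and g: "\<And>x. (g has_vector_derivative g' x) (at x)"
    and g': "continuous_on UNIV g'"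
  shows "norm (g x - steklov_dot h g x) \<le> h * norm (steklov_dot h (\<lambda>t. of_real (norm (g' t)) :: 'a) x)"
proof -
  have cont: "continuous_on UNIV g"
    using g by (meson continuous_at_imp_continuous_on has_vector_derivative_continuous)
  have int: "f integrable_on {a..b}" if "continuous_on UNIV f" for f :: "real \<Rightarrow> 'b::banach" and a b
    using that by (meson continuous_on_subset integrable_continuous_real subset_UNIV)
  have cn: "continuous_on UNIV (\<lambda>t. norm (g' t))"
    using g' by (intro continuous_intros)
  define J where "J = integral {x..x + h} (\<lambda>t. norm (g' t))"
  have J: "0 \<le> J" unfolding J_def by (rule integral_nonneg) (use int cn in auto)
  have osc: "norm (g t - g x) \<le> J" if t: "t \<in> {x..x + h}" for t
  proof -
    have "(g' has_integral (g t - g x)) {x..t}"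
      by (rule fundamental_theorem_of_calculus)
        (use t in \<open>auto intro: has_vector_derivative_at_within g\<close>)
    then have "norm (g t - g x) = norm (integral {x..t} g')"
      by (simp add: integral_unique)
    also have "\<dots> \<le> integral {x..t} (\<lambda>t. norm (g' t))"
      by (rule Henstock_Kurzweil_Integration.integral_norm_bound_integral) (use int g' cn in auto)
    also have "\<dots> \<le> J"
      unfolding J_def by (rule integral_subset_le) (use t int cn in auto)
    finally show ?thesis .
  qed
  have "((\<lambda>t. g t - g x) has_integral (integral {x..x + h} g - h *\<^sub>R g x)) {x..x + h}"
    using has_integral_diff[OF integrable_integral[OF int[OF cont]] has_integral_const_real[of "g x" x "x + h"]] h
    by simp
  then have "norm (integral {x..x + h} g - h *\<^sub>R g x) \<le> J * h"
    using has_integral_bound_real[where B = J and S = "{}" and f = "\<lambda>t. g t - g x" and a = x and b = "x + h"] J osc h by simp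
  moreover have "steklov_dot h g x - g x = (integral {x..x + h} g - h *\<^sub>R g x) /\<^sub>R h"
    using h by (simp add: steklov_dot_eq_integral[OF cont] scaleR_diff_right)
  then have "norm (g x - steklov_dot h g x) = norm (integral {x..x + h} g - h *\<^sub>R g x) / h"
    using h by (subst norm_minus_commute) (simp add: divide_inverse mult.commute)
  ultimately have "norm (g x - steklov_dot h g x) \<le> J"
    using h by (simp add: divide_le_eq)
  moreover have "norm (steklov_dot h (\<lambda>t. of_real (norm (g' t)) :: 'a) x) = J / h"
  proof -
    have "((\<lambda>t. of_real (norm (g' t)) :: 'a) has_integral of_real J) {x..x + h}"
      using has_integral_linear[OF integrable_integral[OF int[OF cn]] bounded_linear_of_real[where 'a = 'a]]
      unfolding J_def o_def by simp
    moreover have "continuous_on UNIV (\<lambda>t. of_real (norm (g' t)) :: 'a)"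
      using g' by (intro continuous_intros)
    ultimately show ?thesis
      using h J by (simp add: steklov_dot_eq_integral integral_unique field_simps)
  qed
  ultimately show ?thesis using h by simp
qed


section \<open>Lattice norm and norm closure\<close>

definition steklov_diff ::
    "real \<Rightarrow> (real \<Rightarrow> 'a::{real_normed_field,euclidean_space}) \<Rightarrow> real \<Rightarrow> 'a" where
  "steklov_diff h g = (\<lambda>x. g x - steklov_dot h g x)"

context banach_lattice
begin

lemma diff_mem: "f \<in> X \<Longrightarrow> g \<in> X \<Longrightarrow> (\<lambda>x. f x - g x) \<in> X"
  by (rule linear_subspace_diff[OF subspace])

lemma scale_mem: "f \<in> X \<Longrightarrow> (\<lambda>x. c * f x) \<in> X"
  by (rule linear_subspace_scale[OF subspace])

lemma zero_mem: "(\<lambda>_. 0) \<in> X"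
  using subspace by (simp add: linear_subspace_def)

lemma N_zero: "N (\<lambda>_. 0) = 0"
  using norm_eq_0_iff[OF zero_mem] by simp

lemma N_diff_le: "f \<in> X \<Longrightarrow> g \<in> X \<Longrightarrow> N (\<lambda>x. f x - g x) \<le> N f + N g"
  using norm_triangle[of f "\<lambda>x. -1 * g x"] scale_mem[of g "-1"] norm_scale[of g "-1"] by simp

lemma N_minus_commute: "f \<in> X \<Longrightarrow> g \<in> X \<Longrightarrow> N (\<lambda>x. f x - g x) = N (\<lambda>x. g x - f x)"
  using norm_scale[OF diff_mem, of f g "-1"] by simp

lemma N_le_N_plus_N_diff:
  assumes "f \<in> X" "g \<in> X"
  shows "N f \<le> N g + N (\<lambda>x. f x - g x)"
  using norm_triangle[OF assms(2) diff_mem[OF assms]] by simp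

lemma modulus_mem:
  assumes f: "f \<in> X"
  shows "(\<lambda>x. of_real (norm (f x))) \<in> X" and "N (\<lambda>x. of_real (norm (f x))) \<le> N f"
proof -
  have [measurable]: "f \<in> borel_measurable lebesgue"
    using f measurable by blast
  have "(\<lambda>x. of_real (norm (f x)) :: 'a) \<in> borel_measurable lebesgue"
    by measurable
  from ideal[OF this f]
  show "(\<lambda>x. of_real (norm (f x))) \<in> X" and "N (\<lambda>x. of_real (norm (f x))) \<le> N f"
    by auto
qed

lemma set_integrable_Icc:
  assumes f: "f \<in> X"
  shows "set_integrable lebesgue {a..b} f"
proof -
  have [measurable]: "f \<in> borel_measurable lebesgue"
    using f measurable by blast
  have E: "{a..b} \<in> sets lebesgue" "emeasure lebesgue {a..b} < \<infinity>"
    by (cases "a \<le> b"; simp)+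
  obtain c where c: "(\<integral>\<^sup>+x\<in>{a..b}. ennreal (norm (f x)) \<partial>lebesgue) \<le> ennreal (c * N f)"
    using integral_bound[OF E] f by blast
  have "(\<integral>\<^sup>+x. ennreal (norm (indicator {a..b} x *\<^sub>R f x)) \<partial>lebesgue)
      = (\<integral>\<^sup>+x\<in>{a..b}. ennreal (norm (f x)) \<partial>lebesgue)"
    by (rule nn_integral_cong) (auto split: split_indicator)
  also have "\<dots> < \<infinity>"
    using c ennreal_less_top le_less_trans by fastforce
  finally show ?thesis
    unfolding set_integrable_def using E
    by (intro integrableI_bounded borel_measurable_scaleR borel_measurable_indicator) auto
qed

text \<open>
  \<open>[x, x + h]\<close> is half of \<open>[x - h, x + h]\<close>. This pointwise domination is how Assumption A, which
  concerns centred averages, applies to one-sided ones, although the norm of \<open>X\<close> may change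
  under translations.
\<close>

lemma norm_steklov_dot_le:
  assumes f: "f \<in> X" and h: "h > 0"
  shows "norm (steklov_dot h f x) \<le> 2 * norm (steklov (2 * h) (\<lambda>t. of_real (norm (f t)) :: 'a) x)"
proof -
  have int: "set_integrable lebesgue {a..b} (\<lambda>t. norm (f t))" for a b
    using set_integrable_Icc[OF f] set_integrable_norm by blast
  have "(LINT t:{x - h..x + h}|lebesgue. (of_real (norm (f t)) :: 'a))
      = of_real (LINT t:{x - h..x + h}|lebesgue. norm (f t))" (is "_ = of_real ?J")
    using integral_bounded_linear[OF bounded_linear_of_real[where 'a = 'a] int[unfolded set_integrable_def]]
    unfolding set_lebesgue_integral_def by (simp add: scaleR_conv_of_real)
  then have avg: "norm (steklov (2 * h) (\<lambda>t. of_real (norm (f t)) :: 'a) x) = \<bar>?J\<bar> / (2 * h)"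
    using h by (simp add: steklov_def field_simps)
  have "norm (LINT t:{x..x + h}|lebesgue. f t) \<le> (LINT t:{x..x + h}|lebesgue. norm (f t))"
    by (rule set_integral_norm_bound[OF set_integrable_Icc[OF f]])
  also have "\<dots> \<le> ?J"
    unfolding set_lebesgue_integral_def
    by (rule integral_mono[OF int[unfolded set_integrable_def] int[unfolded set_integrable_def]])
      (use h in \<open>auto split: split_indicator\<close>)
  finally have "norm (LINT t:{x..x + h}|lebesgue. f t) \<le> \<bar>?J\<bar>" by simp
  then show ?thesis
    unfolding avg using h by (simp add: steklov_dot_eq field_simps)
qed

lemma steklov_diff_linear:
  assumes "f \<in> X" "g \<in> X"
  shows "steklov_diff h (\<lambda>x. f x - g x) = (\<lambda>x. steklov_diff h f x - steklov_diff h g x)"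
  unfolding steklov_diff_def steklov_dot_eq
    set_integral_diff(2)[OF set_integrable_Icc[OF assms(1)] set_integrable_Icc[OF assms(2)]]
  by (simp add: algebra_simps)

definition norm_closure :: "(real \<Rightarrow> 'a) set \<Rightarrow> (real \<Rightarrow> 'a) set" where
  "norm_closure V = {g \<in> X. \<forall>e>0. \<exists>\<psi>\<in>V. N (\<lambda>x. g x - \<psi> x) < e}"

lemma norm_closure_mono: "V \<subseteq> W \<Longrightarrow> norm_closure V \<subseteq> norm_closure W"
  unfolding norm_closure_def by blast

lemma norm_closure_diff:
  assumes V: "linear_subspace V" "V \<subseteq> X" and f: "f \<in> norm_closure V" and g: "g \<in> norm_closure V"
  shows "(\<lambda>x. f x - g x) \<in> norm_closure V"
proof -
  have X: "f \<in> X" "g \<in> X" using f g by (auto simp: norm_closure_def)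
  have "\<exists>\<psi>\<in>V. N (\<lambda>x. f x - g x - \<psi> x) < e" if "e > 0" for e
  proof -
    have "e / 2 > 0" using that by simp
    then obtain u v where uv: "u \<in> V" "N (\<lambda>x. f x - u x) < e / 2" "v \<in> V" "N (\<lambda>x. g x - v x) < e / 2"
      using f g unfolding norm_closure_def mem_Collect_eq by meson
    then have "u \<in> X" "v \<in> X" using V by auto
    then have "N (\<lambda>x. (f x - u x) - (g x - v x)) < e"
      using N_diff_le[OF diff_mem[of f u] diff_mem[of g v]] X uv by linarith
    then have "N (\<lambda>x. f x - g x - (u x - v x)) < e"
      by (simp add: algebra_simps)
    with linear_subspace_diff[OF V(1) uv(1) uv(3)] show ?thesis
      by (intro bexI[of _ "\<lambda>x. u x - v x"])
  qed
  with diff_mem[OF X] show ?thesis by (simp add: norm_closure_def)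
qed

text \<open>
  The sum of the series may lie outside \<open>V\<close>. This is the reason for extending the estimates to
  norm closures.
\<close>

lemma norm_sums_mem_norm_closure:
  assumes V: "linear_subspace V" and u: "\<And>k. u k \<in> V"
    and sums: "norm_sums X N (\<lambda>k x. c k * u k x) g"
  shows "g \<in> norm_closure V"
proof -
  have "\<exists>\<psi>\<in>V. N (\<lambda>x. g x - \<psi> x) < e" if "e > 0" for e
  proof -
    have "\<forall>\<^sub>F (m, n) in sequentially \<times>\<^sub>F sequentially.
        N (\<lambda>x. g x - (\<Sum>k = - int m..int n. c k * u k x)) < e"
      using sums \<open>e > 0\<close> unfolding norm_sums_def
      by (auto dest: order_tendstoD(2) simp: case_prod_unfold)
    then obtain m n where "N (\<lambda>x. g x - (\<Sum>k = - int m..int n. c k * u k x)) < e"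
      unfolding eventually_prod_sequentially by auto
    moreover have "(\<lambda>x. \<Sum>k = - int m..int n. c k * u k x) \<in> V"
      by (rule linear_subspace_sum[OF V u])
    ultimately show ?thesis by (intro bexI[of _ "\<lambda>x. \<Sum>k = - int m..int n. c k * u k x"])
  qed
  with sums show ?thesis by (simp add: norm_closure_def norm_sums_def)
qed

end

section \<open>Iterated differences under Assumption A\<close>

lemma lebesgue_measurable_shift: "(\<lambda>x::real. x + c) \<in> lebesgue \<rightarrow>\<^sub>M lebesgue"
  using lebesgue_affine_measurable[of "\<lambda>_. 1" c] by (simp add: add.commute)

locale averaging_lattice = banach_lattice X N
  for X :: "(real \<Rightarrow> 'a::{real_normed_field,euclidean_space}) set" and N +
  assumes averages_bounded: "assumption_A X N"
begin

lemma steklov_mem: "f \<in> X \<Longrightarrow> h > 0 \<Longrightarrow> steklov h f \<in> X"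
  using averages_bounded by (simp add: assumption_A_def)

text \<open>
  The homogeneous form of the uniform bound on the unit ball. A function of norm zero cannot be
  normalized, but it vanishes almost everywhere and all its averages vanish.
\<close>

lemma steklov_bounded:
  obtains M where "M \<ge> 0" and "\<And>h f. h > 0 \<Longrightarrow> f \<in> X \<Longrightarrow> N (steklov h f) \<le> M * N f"
proof -
  obtain M where M: "N (steklov h f) \<le> M" if "h > 0" "f \<in> X" "N f \<le> 1" for h f
    using averages_bounded unfolding assumption_A_def bdd_above_def by blast
  have "N (steklov h f) \<le> M * N f" if h: "h > 0" and f: "f \<in> X" for h f
  proof (cases "N f = 0")
    case True
    then have ae: "AE x in lebesgue. f x = 0"
      using norm_eq_0_iff[OF f] by simp
    have "(LINT t:A|lebesgue. f t) = 0" for A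
      unfolding set_lebesgue_integral_def
      by (rule integral_eq_zero_AE) (use ae in \<open>auto elim: AE_mp\<close>)
    then have "steklov h f = (\<lambda>_. 0)"
      by (auto simp: steklov_def)
    with True show ?thesis by (simp add: N_zero)
  next
    case False
    then have pos: "N f > 0" using norm_nonneg[OF f] by simp
    define c where "c = (of_real (1 / N f) :: 'a)"
    have c: "norm c = 1 / N f" using pos by (simp add: c_def norm_divide)
    have "N (\<lambda>x. c * f x) \<le> 1"
      using norm_scale[OF f, of c] c pos by simp
    then have "N (steklov h (\<lambda>x. c * f x)) \<le> M"
      using M[OF h scale_mem[OF f]] by blast
    moreover have "steklov h (\<lambda>x. c * f x) = (\<lambda>x. c * steklov h f x)"
      by (auto simp: steklov_def)
    ultimately have "N (steklov h f) / N f \<le> M"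
      using norm_scale[OF steklov_mem[OF f h], of c] c by simp
    then show ?thesis using pos by (simp add: field_simps)
  qed
  moreover have "0 \<le> M"
    using M[of 1 "\<lambda>_. 0"] norm_nonneg[OF steklov_mem[OF zero_mem, of 1]] N_zero zero_mem by simp
  ultimately show thesis using that by blast
qed

lemma steklov_dot_mem:
  assumes f: "f \<in> X" and h: "h > 0"
  shows "steklov_dot h f \<in> X"
    and "N (steklov_dot h f) \<le> 2 * N (steklov (2 * h) (\<lambda>t. of_real (norm (f t))))"
proof -
  have m: "steklov h f \<in> borel_measurable lebesgue"
    using steklov_mem[OF f h] measurable by blast
  have "steklov_dot h f \<in> borel_measurable lebesgue"
    using measurable_compose[OF lebesgue_measurable_shift[of "h / 2"] m]
    by (simp add: steklov_dot_def[abs_def])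
  moreover have S: "steklov (2 * h) (\<lambda>t. of_real (norm (f t))) \<in> X"
    using steklov_mem modulus_mem(1)[OF f] h by simp
  ultimately have "steklov_dot h f \<in> X \<and>
      N (steklov_dot h f) \<le> N (\<lambda>x. 2 * steklov (2 * h) (\<lambda>t. of_real (norm (f t))) x)"
    by (rule ideal[OF _ scale_mem]) (use norm_steklov_dot_le[OF f h] in \<open>simp add: norm_mult\<close>)
  then show "steklov_dot h f \<in> X"
      and "N (steklov_dot h f) \<le> 2 * N (steklov (2 * h) (\<lambda>t. of_real (norm (f t))))"
    using norm_scale[OF S, of 2] by simp_all
qed

lemma steklov_dot_bounded:
  obtains M where "M > 0" and "\<And>h f. h > 0 \<Longrightarrow> f \<in> X \<Longrightarrow> N (steklov_dot h f) \<le> M * N f"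
proof -
  obtain M where M: "M \<ge> 0" and le: "\<And>h f. h > 0 \<Longrightarrow> f \<in> X \<Longrightarrow> N (steklov h f) \<le> M * N f"
    using steklov_bounded by blast
  have "N (steklov_dot h f) \<le> (2 * M + 1) * N f" if h: "h > 0" and f: "f \<in> X" for h f
  proof -
    have "N (steklov_dot h f) \<le> 2 * N (steklov (2 * h) (\<lambda>t. of_real (norm (f t))))"
      by (rule steklov_dot_mem(2)[OF f h])
    also have "\<dots> \<le> 2 * (M * N (\<lambda>t. of_real (norm (f t))))"
      using le[of "2 * h", OF _ modulus_mem(1)[OF f]] h by simp
    also have "\<dots> \<le> 2 * (M * N f)"
      using modulus_mem(2)[OF f] M by (simp add: mult_left_mono)
    also have "\<dots> \<le> (2 * M + 1) * N f"
      using norm_nonneg[OF f] by (simp add: algebra_simps)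
    finally show ?thesis .
  qed
  with M that[of "2 * M + 1"] show thesis by simp
qed

lemma steklov_diff_mem: "f \<in> X \<Longrightarrow> h > 0 \<Longrightarrow> steklov_diff h f \<in> X"
  unfolding steklov_diff_def by (rule diff_mem[OF _ steklov_dot_mem(1)])

lemma steklov_diff_funpow_mem: "f \<in> X \<Longrightarrow> h > 0 \<Longrightarrow> (steklov_diff h ^^ s) f \<in> X"
  by (induction s) (auto intro: steklov_diff_mem)

lemma steklov_diff_funpow_linear:
  assumes "f \<in> X" "g \<in> X" "h > 0"
  shows "(steklov_diff h ^^ s) (\<lambda>x. f x - g x)
    = (\<lambda>x. (steklov_diff h ^^ s) f x - (steklov_diff h ^^ s) g x)"
  by (induction s) (use assms in \<open>auto simp: steklov_diff_linear steklov_diff_funpow_mem\<close>)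

lemma steklov_diff_funpow_bounded:
  obtains L where "L > 0"
    and "\<And>h s f. h > 0 \<Longrightarrow> f \<in> X \<Longrightarrow> N ((steklov_diff h ^^ s) f) \<le> L ^ s * N f"
proof -
  obtain M where M: "M > 0" and le: "\<And>h f. h > 0 \<Longrightarrow> f \<in> X \<Longrightarrow> N (steklov_dot h f) \<le> M * N f"
    using steklov_dot_bounded by blast
  have step: "N (steklov_diff h f) \<le> (1 + M) * N f" if "h > 0" "f \<in> X" for h f
    using N_diff_le[OF that(2) steklov_dot_mem(1)[OF that(2,1)]] le[OF that]
    unfolding steklov_diff_def by (simp add: algebra_simps)
  have "N ((steklov_diff h ^^ s) f) \<le> (1 + M) ^ s * N f" if hf: "h > 0" "f \<in> X" for h s f
  proof (induction s)
    case (Suc s)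
    have "N ((steklov_diff h ^^ Suc s) f) \<le> (1 + M) * N ((steklov_diff h ^^ s) f)"
      using step[OF hf(1) steklov_diff_funpow_mem[OF hf(2,1)]] by simp
    also have "\<dots> \<le> (1 + M) * ((1 + M) ^ s * N f)"
      using Suc M by simp
    finally show ?case by (simp add: mult.assoc)
  qed simp
  with M that[of "1 + M"] show thesis by simp
qed

text \<open>
  The family \<open>G\<close> consists of the successive derivatives of \<open>G 0\<close>. In this form the induction needs no
  smoothness argument: the differences of the members of \<open>G\<close> are again such a family, starting
  at the difference of \<open>G 0\<close>.
\<close>

lemma steklov_diff_funpow_le_derivative:
  obtains M where "M > 0"
    and "\<And>h s G. h > 0 \<Longrightarrow> (\<And>k. G k \<in> X) \<Longrightarrow>
      (\<And>k x. (G k has_vector_derivative G (Suc k) x) (at x)) \<Longrightarrow>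
      N ((steklov_diff h ^^ s) (G 0)) \<le> (M * h) ^ s * N (G s)"
proof -
  obtain M where M: "M > 0" and le: "\<And>h f. h > 0 \<Longrightarrow> f \<in> X \<Longrightarrow> N (steklov_dot h f) \<le> M * N f"
    using steklov_dot_bounded by blast
  have "N ((steklov_diff h ^^ s) (G 0)) \<le> (M * h) ^ s * N (G s)"
    if h: "h > 0" and mem: "\<And>k. G k \<in> X"
      and deriv: "\<And>k x. (G k has_vector_derivative G (Suc k) x) (at x)" for h s G
    using mem deriv
  proof (induction s arbitrary: G)
    case (Suc s)
    have cont: "continuous_on UNIV (G k)" for k
      using Suc.prems(2) by (meson continuous_at_imp_continuous_on has_vector_derivative_continuous)
    have "(steklov_diff h (G k) has_vector_derivative steklov_diff h (G (Suc k)) x) (at x)" for k x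
      unfolding steklov_diff_def
      by (intro has_vector_derivative_diff steklov_dot_has_vector_derivative h Suc.prems(2) cont)
    then have "N ((steklov_diff h ^^ s) (steklov_diff h (G 0))) \<le> (M * h) ^ s * N (steklov_diff h (G s))"
      using Suc.IH[of "\<lambda>k. steklov_diff h (G k)"] steklov_diff_mem[OF Suc.prems(1) h] by blast
    also have "N (steklov_diff h (G s)) \<le> M * h * N (G (Suc s))"
    proof -
      let ?A = "steklov_dot h (\<lambda>t. of_real (norm (G (Suc s) t)) :: 'a)"
      have A: "?A \<in> X" by (rule steklov_dot_mem(1)[OF modulus_mem(1)[OF Suc.prems(1)] h])
      have "AE x in lebesgue. norm (steklov_diff h (G s) x) \<le> norm (of_real h * ?A x)"
        using norm_diff_steklov_dot_le[OF h Suc.prems(2) cont] h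
        by (intro AE_I2) (simp add: steklov_diff_def norm_mult)
      moreover have "steklov_diff h (G s) \<in> borel_measurable lebesgue"
        using steklov_diff_mem[OF Suc.prems(1) h] measurable by blast
      ultimately have "N (steklov_diff h (G s)) \<le> N (\<lambda>x. of_real h * ?A x)"
        using ideal[OF _ scale_mem[OF A]] by blast
      also have "\<dots> = h * N ?A" using norm_scale[OF A] h by simp
      also have "\<dots> \<le> h * (M * N (\<lambda>t. of_real (norm (G (Suc s) t))))"
        using le[OF h modulus_mem(1)[OF Suc.prems(1)]] h by simp
      also have "\<dots> \<le> h * (M * N (G (Suc s)))"
        using modulus_mem(2)[OF Suc.prems(1)] M h by simp
      finally show ?thesis by (simp add: mult_ac)
    qed
    finally show ?case
      using M h by (simp add: funpow_swap1 mult_ac)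
  qed simp
  with M that show thesis by blast
qed

text \<open>
  For \<open>g \<in> \<Phi> \<tau>\<close> the derivative bound is followed by the Bernstein inequality. For a limit \<open>g\<close> the
  uniform boundedness of the differences makes the approximation error negligible; \<open>g\<close> itself need
  not have derivatives.
\<close>

lemma bernstein_norm_closure:
  assumes "bernstein_family X N \<Phi>"
  obtains K where "K > 0"
    and "\<And>h \<tau> s g. h > 0 \<Longrightarrow> \<tau> \<ge> 0 \<Longrightarrow> g \<in> norm_closure (\<Phi> \<tau>) \<Longrightarrow>
      N ((steklov_diff h ^^ s) g) \<le> (K * h * \<tau>) ^ s * N g"
proof -
  obtain M where M: "M > 0"
    and derivative_bound: "\<And>h s G. h > 0 \<Longrightarrow> (\<And>k. G k \<in> X) \<Longrightarrow>
      (\<And>k x. (G k has_vector_derivative G (Suc k) x) (at x)) \<Longrightarrow>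
      N ((steklov_diff h ^^ s) (G 0)) \<le> (M * h) ^ s * N (G s)"
    using steklov_diff_funpow_le_derivative by blast
  obtain L where L: "L > 0"
    and bounded: "\<And>h s f. h > 0 \<Longrightarrow> f \<in> X \<Longrightarrow> N ((steklov_diff h ^^ s) f) \<le> L ^ s * N f"
    using steklov_diff_funpow_bounded by blast
  obtain B where B: "B > 0" and bern: "\<And>\<sigma> \<psi> k. \<sigma> \<ge> 0 \<Longrightarrow> \<psi> \<in> \<Phi> \<sigma> \<Longrightarrow> smooth \<psi> \<and>
      nth_deriv k \<psi> \<in> X \<and> N (nth_deriv k \<psi>) \<le> (B * \<sigma>) ^ k * N \<psi>"
    using assms unfolding bernstein_family_def by metis
  have smooth_case: "N ((steklov_diff h ^^ s) \<psi>) \<le> (M * B * h * \<tau>) ^ s * N \<psi>"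
    if h: "h > 0" and \<tau>: "\<tau> \<ge> 0" and \<psi>: "\<psi> \<in> \<Phi> \<tau>" for h \<tau> s \<psi>
  proof -
    have "(nth_deriv k \<psi> has_vector_derivative nth_deriv (Suc k) \<psi> x) (at x)" for k x
      using bern[OF \<tau> \<psi>] by (simp add: smooth_def nth_deriv_def vector_derivative_works)
    then have "N ((steklov_diff h ^^ s) (nth_deriv 0 \<psi>)) \<le> (M * h) ^ s * N (nth_deriv s \<psi>)"
      using bern[OF \<tau> \<psi>] by (intro derivative_bound h) auto
    also have "\<dots> \<le> (M * h) ^ s * ((B * \<tau>) ^ s * N \<psi>)"
      using bern[OF \<tau> \<psi>] M h by (intro mult_left_mono) auto
    finally show ?thesis by (simp add: nth_deriv_def power_mult_distrib mult_ac)
  qed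
  have "N ((steklov_diff h ^^ s) g) \<le> (M * B * h * \<tau>) ^ s * N g"
    if h: "h > 0" and \<tau>: "\<tau> \<ge> 0" and g: "g \<in> norm_closure (\<Phi> \<tau>)" for h \<tau> s g
  proof -
    define b where "b = (M * B * h * \<tau>) ^ s"
    have b: "b \<ge> 0" unfolding b_def using M B h \<tau> by simp
    have gX: "g \<in> X" using g by (simp add: norm_closure_def)
    have approx: "N ((steklov_diff h ^^ s) g) \<le> b * N g + (L ^ s + b) * e" if "e > 0" for e
    proof -
      obtain \<psi> where \<psi>: "\<psi> \<in> \<Phi> \<tau>" and e: "N (\<lambda>x. g x - \<psi> x) < e"
        using g \<open>e > 0\<close> by (auto simp: norm_closure_def)
      have \<psi>X: "\<psi> \<in> X" using \<psi> \<tau> assms by (auto simp: bernstein_family_def)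
      have "N ((steklov_diff h ^^ s) g)
          \<le> N ((steklov_diff h ^^ s) \<psi>) + N ((steklov_diff h ^^ s) (\<lambda>x. g x - \<psi> x))"
        using N_le_N_plus_N_diff[OF steklov_diff_funpow_mem[OF gX h] steklov_diff_funpow_mem[OF \<psi>X h]]
        by (simp add: steklov_diff_funpow_linear[OF gX \<psi>X h])
      also have "\<dots> \<le> b * N \<psi> + L ^ s * N (\<lambda>x. g x - \<psi> x)"
        using smooth_case[OF h \<tau> \<psi>] bounded[OF h diff_mem[OF gX \<psi>X]] by (simp add: b_def add_mono)
      also have "\<dots> \<le> b * (N g + e) + L ^ s * e"
        using N_le_N_plus_N_diff[OF \<psi>X gX] N_minus_commute[OF gX \<psi>X] e b L
        by (intro add_mono mult_left_mono) auto
      finally show ?thesis by (simp add: algebra_simps)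
    qed
    have "N ((steklov_diff h ^^ s) g) \<le> b * N g"
    proof (rule field_le_epsilon)
      fix e :: real assume "e > 0"
      have "L ^ s + b > 0" using L b by (simp add: add_pos_nonneg)
      then show "N ((steklov_diff h ^^ s) g) \<le> b * N g + e"
        using approx[of "e / (L ^ s + b)"] \<open>e > 0\<close> by simp
    qed
    then show ?thesis by (simp add: b_def)
  qed
  with M B that[of "M * B"] show thesis by simp
qed

end

section \<open>Dyadic decomposition\<close>

text \<open>
  For \<open>j \<ge> 1\<close> the index \<open>m j\<close> minimizes \<open>a\<close> over the block \<open>2^(j-1) \<le> \<nu> < 2^j\<close>, which has \<open>2^(j-1)\<close>
  elements, on each of which the weight \<open>(\<nu> + 1)^(s-1)\<close> is at least \<open>(2^(j-1))^(s-1)\<close>; thus the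
  weighted sum over the block is at least \<open>2^((j-1)s) a (m j)\<close>. The blocks are
  disjoint, so these sums add up to the sum over all \<open>\<nu> < 2^n\<close>.
\<close>

lemma dyadic_minimizers:
  fixes a :: "nat \<Rightarrow> real"
  assumes s: "s \<ge> 1" and a: "\<And>\<nu>. a \<nu> \<ge> 0"
  obtains m :: "nat \<Rightarrow> nat" where "m 0 = 0" and "\<And>j. m j < 2 ^ j"
    and "\<And>n. (\<Sum>j\<le>n. 2 ^ (j * s) * a (m j)) \<le> 2 ^ s * (\<Sum>\<nu><2 ^ n. (real \<nu> + 1) ^ (s - 1) * a \<nu>)"
proof -
  \<comment> \<open>Truncating division makes the block for \<open>j = 0\<close> equal to \<open>{0}\<close>.\<close>
  define block where "block j = {2 ^ j div 2..<2 ^ j :: nat}" for j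
  define m where "m j = arg_min_on a (block j)" for j
  have fin: "finite (block j)" and ne: "block j \<noteq> {}" for j
    by (auto simp: block_def)
  have m: "m j \<in> block j" and min: "\<And>\<nu>. \<nu> \<in> block j \<Longrightarrow> a (m j) \<le> a \<nu>" for j
    unfolding m_def using arg_min_if_finite(1)[OF fin ne, where f = a] arg_min_least[OF fin ne, where f = a] by auto
  let ?w = "\<lambda>\<nu>. (real \<nu> + 1) ^ (s - 1) * a \<nu>"
  have m0: "m 0 = 0" using m[of 0] by (simp add: block_def)
  have blocks: "2 ^ (Suc j * s) * a (m (Suc j)) \<le> 2 ^ s * sum ?w (block (Suc j))" for j
  proof -
    have "2 ^ (Suc j * s) * a (m (Suc j)) = 2 ^ s * (2 ^ j * ((2 ^ j) ^ (s - 1) * a (m (Suc j))))"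
    proof -
      have "(2 ^ j :: real) * (2 ^ j) ^ (s - 1) = (2 ^ j) ^ s"
        using s by (cases s) simp_all
      then show ?thesis by (simp add: power_add flip: power_mult mult.assoc)
    qed
    also have "2 ^ j * ((2 ^ j) ^ (s - 1) * a (m (Suc j)))
        = (\<Sum>\<nu>\<in>block (Suc j). (2 ^ j) ^ (s - 1) * a (m (Suc j)))"
      by (simp add: block_def)
    also have "\<dots> \<le> sum ?w (block (Suc j))"
    proof (intro sum_mono mult_mono power_mono)
      fix \<nu> assume \<nu>: "\<nu> \<in> block (Suc j)"
      then have "2 ^ j \<le> \<nu>" by (simp add: block_def)
      then have "real (2 ^ j) \<le> real \<nu>" by (rule of_nat_mono)
      then show "(2 ^ j :: real) \<le> real \<nu> + 1" unfolding of_nat_power of_nat_numeral by linarith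
    qed (use a min in auto)
    finally show ?thesis by simp
  qed
  have "(\<Sum>j\<le>n. 2 ^ (j * s) * a (m j)) \<le> 2 ^ s * sum ?w {..<2 ^ n}" for n
  proof (induction n)
    case 0
    have "a 0 * 1 \<le> a 0 * 2 ^ s" by (intro mult_left_mono a) simp
    then show ?case by (simp add: m0 mult.commute)
  next
    case (Suc n)
    have split: "{..<2 ^ Suc n} = {..<2 ^ n} \<union> block (Suc n)" and "{..<2 ^ n} \<inter> block (Suc n) = {}"
      by (auto simp: block_def)
    then have "sum ?w {..<2 ^ Suc n} = sum ?w {..<2 ^ n} + sum ?w (block (Suc n))"
      by (simp only: split) (rule sum.union_disjoint, auto simp: fin)
    with Suc blocks[of n] show ?case by (simp add: algebra_simps)
  qed
  moreover have "m j < 2 ^ j" for j using m[of j] by (simp add: block_def)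
  ultimately show thesis using m0 that by blast
qed

context averaging_lattice
begin

text \<open>
  Here \<open>P (Suc j) - P j\<close> is replaced by the sum of the errors of \<open>P j\<close> and \<open>P (Suc j)\<close>. The error
  of \<open>P j\<close> is thus counted with the weights \<open>2^(js)\<close> and \<open>2^((j+1)s)\<close>, whence the factor
  \<open>1 + 2^s\<close>.
\<close>

lemma telescoping_bound:
  assumes h: "h > 0" and K: "K > 0" and f: "f \<in> X"
    and P0: "P 0 = (\<lambda>_. 0)" and P: "\<And>j. P j \<in> X"
    and bern: "\<And>j. N ((steklov_diff h ^^ s) (\<lambda>x. P (Suc j) x - P j x))
      \<le> (K * h * 2 ^ Suc j) ^ s * N (\<lambda>x. P (Suc j) x - P j x)"
  shows "N ((steklov_diff h ^^ s) (P n))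
    \<le> (K * h) ^ s * (1 + 2 ^ s) * (\<Sum>j\<le>n. 2 ^ (j * s) * N (\<lambda>x. f x - P j x))"
proof -
  define E where "E j = N (\<lambda>x. f x - P j x)" for j
  have E: "E j \<ge> 0" for j unfolding E_def by (intro norm_nonneg diff_mem f P)
  have "N ((steklov_diff h ^^ s) (P n))
    \<le> (K * h) ^ s * ((\<Sum>j\<le>n. 2 ^ (j * s) * E j) + 2 ^ s * (\<Sum>j<n. 2 ^ (j * s) * E j))"
  proof (induction n)
    case 0
    have "(steklov_diff h ^^ s) (\<lambda>_. 0 :: 'a) = (\<lambda>_. 0)"
      using steklov_diff_funpow_linear[OF zero_mem zero_mem h, of s] by simp
    then show ?case using E[of 0] K h by (simp add: P0 N_zero)
  next
    case (Suc n)
    have "N ((steklov_diff h ^^ s) (P (Suc n)))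
        \<le> N ((steklov_diff h ^^ s) (P n)) + N ((steklov_diff h ^^ s) (\<lambda>x. P (Suc n) x - P n x))"
      using N_le_N_plus_N_diff[OF steklov_diff_funpow_mem[OF P h] steklov_diff_funpow_mem[OF P h], of s "Suc n" s n]
      by (simp add: steklov_diff_funpow_linear[OF P P h])
    moreover have "N (\<lambda>x. P (Suc n) x - P n x) \<le> E (Suc n) + E n"
    proof -
      have "N (\<lambda>x. (f x - P n x) - (f x - P (Suc n) x)) \<le> E n + E (Suc n)"
        unfolding E_def by (intro N_diff_le diff_mem f P)
      then show ?thesis by (simp add: add.commute)
    qed
    then have "N ((steklov_diff h ^^ s) (\<lambda>x. P (Suc n) x - P n x))
        \<le> (K * h * 2 ^ Suc n) ^ s * (E (Suc n) + E n)"
      using K h by (intro order_trans[OF bern] mult_left_mono) auto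
    moreover have "(K * h * 2 ^ Suc n) ^ s * (E (Suc n) + E n)
        = (K * h) ^ s * (2 ^ (Suc n * s) * E (Suc n) + 2 ^ s * (2 ^ (n * s) * E n))"
      by (simp add: power_mult_distrib power_add algebra_simps flip: power_mult)
    ultimately show ?case using Suc by (simp add: algebra_simps)
  qed
  also have "\<dots> \<le> (K * h) ^ s * ((\<Sum>j\<le>n. 2 ^ (j * s) * E j) + 2 ^ s * (\<Sum>j\<le>n. 2 ^ (j * s) * E j))"
    using K h E by (intro mult_left_mono add_left_mono sum_mono2) auto
  finally show ?thesis by (simp add: E_def algebra_simps)
qed

text \<open>
  The norm of \<open>D^s (f - P\<^sub>n)\<close> is at most a constant times \<open>a (m n)\<close>, and \<open>\<sigma> < 2^(n+1)\<close> turns this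
  into \<open>\<sigma>^(-s)\<close> times the term \<open>2^(ns) a (m n)\<close> of the dyadic sum; in the Bernstein bound for
  \<open>D^s P\<^sub>n\<close> the factor \<open>\<sigma>^(-s)\<close> comes from \<open>h = \<gamma> / \<sigma>\<close>. The constant is uniform in \<open>Q\<close> because the
  approximants will depend on \<open>f\<close>.
\<close>

theorem inverse_approximation:
  assumes \<Phi>: "bernstein_family X N \<Phi>" and \<gamma>: "\<gamma> > 0" and s: "s \<ge> 1"
  shows "\<exists>C>0. \<forall>f\<in>X. \<forall>\<sigma>>0. \<forall>Q. Q 0 = (\<lambda>_. 0) \<and> (\<forall>\<nu>. Q \<nu> \<in> norm_closure (\<Phi> (real \<nu>))) \<longrightarrow>
    N ((steklov_diff (\<gamma> / \<sigma>) ^^ s) f)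
      \<le> C / \<sigma> ^ s * (\<Sum>\<nu>=0..nat \<lfloor>\<sigma>\<rfloor>. (real \<nu> + 1) ^ (s - 1) * N (\<lambda>x. f x - Q \<nu> x))"
proof -
  obtain K where K: "K > 0" and bern: "\<And>h \<tau> s g. h > 0 \<Longrightarrow> \<tau> \<ge> 0 \<Longrightarrow> g \<in> norm_closure (\<Phi> \<tau>) \<Longrightarrow>
      N ((steklov_diff h ^^ s) g) \<le> (K * h * \<tau>) ^ s * N g"
    using bernstein_norm_closure[OF \<Phi>] by blast
  obtain L where L: "L > 0"
    and bounded: "\<And>h s f. h > 0 \<Longrightarrow> f \<in> X \<Longrightarrow> N ((steklov_diff h ^^ s) f) \<le> L ^ s * N f"
    using steklov_diff_funpow_bounded by blast
  define C where "C = 2 ^ s * ((2 * L) ^ s + (K * \<gamma>) ^ s * (1 + 2 ^ s))"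
  have "N ((steklov_diff (\<gamma> / \<sigma>) ^^ s) f)
      \<le> C / \<sigma> ^ s * (\<Sum>\<nu>=0..nat \<lfloor>\<sigma>\<rfloor>. (real \<nu> + 1) ^ (s - 1) * N (\<lambda>x. f x - Q \<nu> x))"
    if f: "f \<in> X" and \<sigma>: "\<sigma> > 0" and Q0: "Q 0 = (\<lambda>_. 0)"
      and Q: "\<And>\<nu>. Q \<nu> \<in> norm_closure (\<Phi> (real \<nu>))" for f \<sigma> and Q :: "nat \<Rightarrow> real \<Rightarrow> 'a"
  proof -
    define h where "h = \<gamma> / \<sigma>"
    have h: "h > 0" using \<gamma> \<sigma> by (simp add: h_def)
    have QX: "Q \<nu> \<in> X" for \<nu> using Q by (simp add: norm_closure_def)
    define a where "a \<nu> = N (\<lambda>x. f x - Q \<nu> x)" for \<nu>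
    have a: "a \<nu> \<ge> 0" for \<nu> unfolding a_def by (intro norm_nonneg diff_mem f QX)
    obtain m :: "nat \<Rightarrow> nat" where m0: "m 0 = 0" and m: "\<And>j. m j < 2 ^ j"
      and weights: "\<And>n. (\<Sum>j\<le>n. 2 ^ (j * s) * a (m j))
        \<le> 2 ^ s * (\<Sum>\<nu><2 ^ n. (real \<nu> + 1) ^ (s - 1) * a \<nu>)"
      using dyadic_minimizers[OF s, of a] a by blast
    have Qm: "Q (m i) \<in> norm_closure (\<Phi> (2 ^ j))" if "i \<le> j" for i j
    proof -
      have "m i \<le> 2 ^ j"
        using m[of i] that power_increasing[of i j "2::nat"] by linarith
      then have "real (m i) \<le> 2 ^ j" by (metis of_nat_le_iff of_nat_numeral of_nat_power)
      then have "\<Phi> (real (m i)) \<subseteq> \<Phi> (2 ^ j)"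
        using \<Phi> unfolding bernstein_family_def by (meson of_nat_0_le_iff)
      then show ?thesis using Q norm_closure_mono by blast
    qed
    have \<Phi>_sub: "linear_subspace (\<Phi> (2 ^ j))" "\<Phi> (2 ^ j) \<subseteq> X" for j
      using \<Phi> by (simp_all add: bernstein_family_def)
    \<comment> \<open>The least such \<open>n\<close> is \<open>0\<close> or satisfies \<open>2 ^ n \<le> \<sigma>\<close>. In both cases the blocks up to \<open>n\<close>
      stay within the range of summation, also for \<open>\<sigma> < 1\<close>.\<close>
    have "\<exists>n. \<sigma> < 2 ^ Suc n"
    proof -
      obtain k where "\<sigma> < 2 ^ k" using real_arch_pow[of 2 \<sigma>] by auto
      also have "(2 ^ k :: real) \<le> 2 ^ Suc k" by simp
      finally show ?thesis by blast
    qed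
    then obtain n where n: "\<sigma> < 2 ^ Suc n" and least: "\<And>i. i < n \<Longrightarrow> 2 ^ Suc i \<le> \<sigma>"
      unfolding exists_least_iff[of "\<lambda>n. \<sigma> < 2 ^ Suc n"] by (auto simp: not_less)
    have range: "{..<2 ^ n} \<subseteq> {0..nat \<lfloor>\<sigma>\<rfloor>}"
    proof (cases n)
      case (Suc i)
      then have "2 ^ n \<le> \<sigma>" using least[of i] by simp
      then have "2 ^ n \<le> nat \<lfloor>\<sigma>\<rfloor>" by (intro le_nat_floor) simp
      then show ?thesis by (intro subsetI) (simp only: lessThan_iff atLeastAtMost_iff, linarith)
    qed auto
    define S where "S = (\<Sum>\<nu>=0..nat \<lfloor>\<sigma>\<rfloor>. (real \<nu> + 1) ^ (s - 1) * a \<nu>)"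
    define W where "W = (\<Sum>j\<le>n. 2 ^ (j * s) * a (m j))"
    have "W \<le> 2 ^ s * (\<Sum>\<nu><2 ^ n. (real \<nu> + 1) ^ (s - 1) * a \<nu>)"
      unfolding W_def by (rule weights)
    also have "\<dots> \<le> 2 ^ s * S"
      unfolding S_def using range a by (intro mult_left_mono sum_mono2) auto
    finally have W: "W \<le> 2 ^ s * S" .
    have "N ((steklov_diff h ^^ s) f)
        \<le> N ((steklov_diff h ^^ s) (Q (m n))) + N ((steklov_diff h ^^ s) (\<lambda>x. f x - Q (m n) x))"
      using N_le_N_plus_N_diff[OF steklov_diff_funpow_mem[OF f h] steklov_diff_funpow_mem[OF QX h]]
      by (simp add: steklov_diff_funpow_linear[OF f QX h])
    also have "N ((steklov_diff h ^^ s) (Q (m n))) \<le> (K * h) ^ s * (1 + 2 ^ s) * W"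
      unfolding W_def a_def
    proof (rule telescoping_bound[OF h K f, where P = "\<lambda>j. Q (m j)"])
      fix j
      show "N ((steklov_diff h ^^ s) (\<lambda>x. Q (m (Suc j)) x - Q (m j) x))
          \<le> (K * h * 2 ^ Suc j) ^ s * N (\<lambda>x. Q (m (Suc j)) x - Q (m j) x)"
        by (rule bern[OF h _ norm_closure_diff[OF \<Phi>_sub Qm Qm]]) auto
    qed (simp_all add: m0 Q0 QX)
    also have "N ((steklov_diff h ^^ s) (\<lambda>x. f x - Q (m n) x)) \<le> L ^ s * a (m n)"
      unfolding a_def by (rule bounded[OF h diff_mem[OF f QX]])
    also have "L ^ s * a (m n) \<le> (2 * L) ^ s / \<sigma> ^ s * W"
    proof -
      have "\<sigma> ^ s * a (m n) \<le> (2 ^ Suc n) ^ s * a (m n)"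
        using n \<sigma> a by (intro mult_right_mono power_mono) auto
      also have "\<dots> = 2 ^ s * (2 ^ (n * s) * a (m n))"
        by (simp add: power_mult_distrib power_mult)
      also have "\<dots> \<le> 2 ^ s * W"
        unfolding W_def using a
        by (intro mult_left_mono member_le_sum[where f = "\<lambda>j. 2 ^ (j * s) * a (m j)"]) auto
      finally have "a (m n) \<le> 2 ^ s * W / \<sigma> ^ s" using \<sigma> by (simp add: field_simps)
      then have "L ^ s * a (m n) \<le> L ^ s * (2 ^ s * W / \<sigma> ^ s)"
        using L by (intro mult_left_mono) auto
      then show ?thesis by (simp add: power_mult_distrib mult_ac)
    qed
    finally have "N ((steklov_diff h ^^ s) f)
        \<le> ((2 * L) ^ s + (K * \<gamma>) ^ s * (1 + 2 ^ s)) / \<sigma> ^ s * W"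
      by (simp add: h_def power_divide power_mult_distrib add_divide_distrib algebra_simps)
    also have "\<dots> \<le> ((2 * L) ^ s + (K * \<gamma>) ^ s * (1 + 2 ^ s)) / \<sigma> ^ s * (2 ^ s * S)"
      using W L K \<gamma> \<sigma> by (intro mult_left_mono) auto
    finally show ?thesis by (simp add: C_def S_def a_def h_def mult_ac)
  qed
  moreover have "C > 0" unfolding C_def using L K \<gamma> by (intro mult_pos_pos add_pos_pos) auto
  ultimately show ?thesis by blast
qed

end

theorem theorem4p2:
  fixes X :: "(real \<Rightarrow> 'a::{real_normed_field,euclidean_space}) set"
    and N :: "(real \<Rightarrow> 'a) \<Rightarrow> real"
    and \<Phi> :: "real \<Rightarrow> (real \<Rightarrow> 'a) set"
    and \<phi> :: "real \<Rightarrow> int \<Rightarrow> real \<Rightarrow> 'a"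
    and p :: "real \<Rightarrow> int \<Rightarrow> real"
    and \<gamma> \<gamma>' :: real
    and r s :: nat
  assumes "banach_lattice X N"
    and "assumption_A X N"
    and "r \<ge> 1" and "s \<ge> 1"
    and "bernstein_family X N \<Phi>"
    and "\<And>\<sigma> k. \<sigma> > 0 \<Longrightarrow> \<phi> \<sigma> k \<in> \<Phi> \<sigma>"
    and "\<gamma> > 0" and "\<gamma>' > 0"
    and "\<And>\<sigma>. \<sigma> > 0 \<Longrightarrow> inj (p \<sigma>)"
    and "\<And>\<sigma> k. \<sigma> > 0 \<Longrightarrow> \<gamma> / \<sigma> \<le> p \<sigma> (k + 1) - p \<sigma> k \<and> p \<sigma> (k + 1) - p \<sigma> k \<le> \<gamma>' / \<sigma>"
    and "\<And>\<sigma> f. \<sigma> > 0 \<Longrightarrow> f \<in> X \<Longrightarrow> \<exists>g. norm_sums X N (kantorovich_term \<gamma> p \<phi> r \<sigma> f) g"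
    and "(\<exists>\<sigma>>0. \<exists>k. \<not> compactly_supported (\<phi> \<sigma> k)) \<Longrightarrow>
           order_continuous_norm X N \<and> dense_subspace X N schwartz"
  shows "\<exists>C>0. \<forall>f\<in>X. \<forall>\<sigma>>0.
    N (((\<lambda>g x. g x - steklov_dot (\<gamma> / \<sigma>) g x) ^^ s) f)
      \<le> C / \<sigma> ^ s * (\<Sum>\<nu>=0..nat \<lfloor>\<sigma>\<rfloor>. (real \<nu> + 1) ^ (s - 1) *
            N (\<lambda>x. f x - kantorovich X N \<gamma> p \<phi> r (real \<nu>) f x))"
proof -
  interpret averaging_lattice X N
    using assms(1,2) by (simp add: averaging_lattice_def averaging_lattice_axioms_def)
  have subspace: "linear_subspace (\<Phi> \<tau>)" if "\<tau> \<ge> 0" for \<tau>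
    using assms(5) that by (simp add: bernstein_family_def)
  have mem: "kantorovich X N \<gamma> p \<phi> r (real \<nu>) f \<in> norm_closure (\<Phi> (real \<nu>))" if f: "f \<in> X" for f \<nu>
  proof (cases "\<nu> = 0")
    case True
    have "\<Phi> 0 = {\<lambda>_. 0}" using assms(5) by (simp add: bernstein_family_def)
    then show ?thesis using True by (simp add: kantorovich_def norm_closure_def zero_mem N_zero)
  next
    case False
    then have \<nu>: "real \<nu> > 0" by simp
    have "norm_sums X N (kantorovich_term \<gamma> p \<phi> r (real \<nu>) f) (kantorovich X N \<gamma> p \<phi> r (real \<nu>) f)"
      using someI_ex[OF assms(11)[OF \<nu> f]] False by (simp add: kantorovich_def)
    then show ?thesis
      unfolding kantorovich_term_def[abs_def]
      by (rule norm_sums_mem_norm_closure[OF subspace assms(6)[OF \<nu>], rotated]) simp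
  qed
  obtain C where "C > 0" and C: "\<forall>f\<in>X. \<forall>\<sigma>>0. \<forall>Q. Q 0 = (\<lambda>_. 0) \<and>
      (\<forall>\<nu>. Q \<nu> \<in> norm_closure (\<Phi> (real \<nu>))) \<longrightarrow>
      N ((steklov_diff (\<gamma> / \<sigma>) ^^ s) f)
        \<le> C / \<sigma> ^ s * (\<Sum>\<nu>=0..nat \<lfloor>\<sigma>\<rfloor>. (real \<nu> + 1) ^ (s - 1) * N (\<lambda>x. f x - Q \<nu> x))"
    using inverse_approximation[OF assms(5,7,4)] by (elim exE conjE)
  show ?thesis
  proof (intro exI[of _ C] conjI ballI allI impI \<open>C > 0\<close>)
    fix f and \<sigma> :: real assume f: "f \<in> X" and \<sigma>: "\<sigma> > 0"
    have "kantorovich X N \<gamma> p \<phi> r (real 0) f = (\<lambda>_. 0)"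
      by (simp add: kantorovich_def)
    then have "N ((steklov_diff (\<gamma> / \<sigma>) ^^ s) f)
      \<le> C / \<sigma> ^ s * (\<Sum>\<nu>=0..nat \<lfloor>\<sigma>\<rfloor>. (real \<nu> + 1) ^ (s - 1) *
            N (\<lambda>x. f x - kantorovich X N \<gamma> p \<phi> r (real \<nu>) f x))"
      using mem[OF f]
      by (intro C[THEN bspec, OF f, THEN spec, THEN mp, OF \<sigma>, THEN spec, THEN mp,
            of "\<lambda>\<nu>. kantorovich X N \<gamma> p \<phi> r (real \<nu>) f"] conjI allI)
    then show "N (((\<lambda>g x. g x - steklov_dot (\<gamma> / \<sigma>) g x) ^^ s) f)
      \<le> C / \<sigma> ^ s * (\<Sum>\<nu>=0..nat \<lfloor>\<sigma>\<rfloor>. (real \<nu> + 1) ^ (s - 1) *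
            N (\<lambda>x. f x - kantorovich X N \<gamma> p \<phi> r (real \<nu>) f x))"
      unfolding steklov_diff_def[abs_def] .
  qed
qed

end
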